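(* Let $p\geq1$ and let $a_i,b_i>0$ be such that $$b_i>\frac{a_i-1+\sqrt{(a_i+1)^2+4a_i(e-1)(a_i+1)}}{2}\qquad\text{for } 1\leq i\leq p.$$ Then the normalized hypergeometric function $${}_p\tilde{F}_{p}\left[{a_1,\dots,a_p\atop b_1,\dots,b_p}\Big|z\right]=z\;{}_pF_{p}\left[{a_1,\dots,a_p\atop b_1,\dots,b_p}\Big|z\right]$$ is starlike in $\mathcal{D}_{1/2}=\{z\in\mathbb{C}:|z|<1/2\}$.
   Context: ${}_pF_q\left[{a_1,\dots,a_p\atop b_1,\dots,b_q}\big|z\right]=\sum_{k=0}^\infty\frac{(a_1)_k\cdots(a_p)_k}{(b_1)_k\cdots(b_q)_k}\frac{z^k}{k!}$ is the generalized hypergeometric function, with $(a)_k=\Gamma(a+k)/\Gamma(a)$. A function $f(z)=z+\sum_{k\ge2}c_kz^k$ analytic in the unit disc is starlike in $\mathcal{D}_{1/2}$ if it is univalent in $\mathcal{D}_{1/2}$ and $f(\mathcal{D}_{1/2})$ is starlike with respect to the origin; equivalently $\Re\left(zf'(z)/f(z)\right)>0$ for $|z|<1/2$. Here $e=\exp(1)$. *)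

theory Defs
  imports "HOL-Complex_Analysis.Complex_Analysis"
begin

text \<open>
  The generalized hypergeometric function as the sum of its power series. The lengths of the lists
  are the indices \<open>p\<close> and \<open>q\<close>; the scaling argument \<open>1\<close> makes \<open>fps_hypergeo\<close> the plain series in \<open>z\<close>.
\<close>

definition hypergeom :: "complex list \<Rightarrow> complex list \<Rightarrow> complex \<Rightarrow> complex" where
  "hypergeom a b z = eval_fps (fps_hypergeo a b 1) z"

lemma hypergeom_series:
  "hypergeom a b z =
     (\<Sum>k. (\<Prod>x\<leftarrow>a. pochhammer x k) / (\<Prod>x\<leftarrow>b. pochhammer x k) * (z ^ k / fact k))"
proof -
  have foldl_mult: "foldl (\<lambda>r x. r * f x) c xs = c * (\<Prod>x\<leftarrow>xs. f x)"
    for f :: "complex \<Rightarrow> complex" and c xs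
    by (induction xs arbitrary: c) (auto simp: mult.assoc)
  show ?thesis
    by (simp add: hypergeom_def eval_fps_def foldl_mult)
qed

definition hypergeom_normalized :: "complex list \<Rightarrow> complex list \<Rightarrow> complex \<Rightarrow> complex" where
  "hypergeom_normalized a b z = z * hypergeom a b z"

text \<open>
  The library predicate \<open>starlike\<close> lets the centre be any point of the set, so it cannot be used
  for sets that are starlike with respect to a given point.
\<close>

definition starlike_wrt :: "'a::real_vector \<Rightarrow> 'a set \<Rightarrow> bool" where
  "starlike_wrt c S \<longleftrightarrow> c \<in> S \<and> (\<forall>x\<in>S. closed_segment c x \<subseteq> S)"

text \<open>
  The first three conjuncts say that \<open>f\<close> is analytic in the unit disc with Taylor expansion
  \<open>z + \<dots>\<close>; given analyticity, univalence is injectivity. Meant for \<open>0 < r \<le> 1\<close>.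
\<close>

definition starlike_in_disc :: "(complex \<Rightarrow> complex) \<Rightarrow> real \<Rightarrow> bool" where
  "starlike_in_disc f r \<longleftrightarrow>
     f holomorphic_on ball 0 1 \<and> f 0 = 0 \<and> deriv f 0 = 1 \<and>
     inj_on f (ball 0 r) \<and> starlike_wrt 0 (f ` ball 0 r)"

end

theory Submission
  imports Defs
begin

text \<open>
  Write the normalized function as \<open>f z = z * F z\<close>, where \<open>F = 1 + (\<Sum>k\<ge>1. c\<^sub>k z^k)\<close>. All the quotients
  \<open>(a\<^sub>i)\<^sub>k / (b\<^sub>i)\<^sub>k\<close> are at most \<open>1\<close>, so already one pair \<open>a\<close>, \<open>b\<close> of parameters gives
  \<open>(\<Sum>k\<ge>1. c\<^sub>k) \<le> a / b + (e - 1) a (a + 1) / (b (b + 1))\<close>; the hypothesis on \<open>b\<close> says that this is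
  less than \<open>1\<close>. As \<open>k + 1 \<le> 2^k\<close>, for \<open>|z| < 1/2\<close> the sum of \<open>|F - 1|\<close> and \<open>|z F'|\<close> is bounded by
  \<open>\<Sum>k\<ge>1. c\<^sub>k < 1\<close>. Hence \<open>|f' - 1|\<close> is bounded away from \<open>1\<close>, which makes \<open>f\<close> injective, and
  \<open>|z f' / f - 1| = |z F' / F| < 1\<close>, which makes its image starlike.
\<close>

section \<open>Starlikeness of the image from positivity of Re (z f' / f)\<close>

text \<open>
  Pulled back by the inverse \<open>g\<close> of \<open>f\<close>, the segment from \<open>0\<close> to \<open>w = f z\<close> becomes a curve
  \<open>t \<mapsto> g (t w)\<close> whose modulus increases with \<open>t\<close> by the positivity hypothesis. So, running \<open>t\<close> down
  from \<open>1\<close>, it cannot leave the compact disc of radius \<open>|z|\<close>.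
\<close>

lemma starlike_wrt_image_ball:
  fixes f :: "complex \<Rightarrow> complex"
  assumes holf: "f holomorphic_on ball 0 r" and inj: "inj_on f (ball 0 r)" and f0: "f 0 = 0"
    and r: "0 < r"
    and pos: "\<And>z. z \<in> ball 0 r \<Longrightarrow> z \<noteq> 0 \<Longrightarrow> 0 < Re (z * deriv f z / f z)"
  shows "starlike_wrt 0 (f ` ball 0 r)"
proof -
  obtain g where holg: "g holomorphic_on (f ` ball 0 r)"
    and dg: "\<And>z. z \<in> ball 0 r \<Longrightarrow> deriv f z * deriv g (f z) = 1"
    and gf: "\<And>z. z \<in> ball 0 r \<Longrightarrow> g (f z) = z"
    using holomorphic_has_inverse[OF holf open_ball inj] by metis
  have opn: "open (f ` ball 0 r)"
    using open_mapping_thm3[OF holf open_ball inj] .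
  have seg: "s *\<^sub>R f z \<in> f ` ball 0 r" if z: "z \<in> ball 0 r" and s: "0 \<le> s" "s \<le> 1" for z s
  proof (cases "z = 0")
    case True
    then show ?thesis using f0 r by auto
  next
    case False
    define w where "w = f z"
    have "f z \<noteq> f 0" using inj z False r by (auto simp: inj_on_def)
    then have w0: "w \<noteq> 0" using f0 by (simp add: w_def)
    have sub: "cball 0 (norm z) \<subseteq> ball (0::complex) r" using z by auto
    \<comment> \<open>These are the parameters \<open>u\<close> in [s, 1] for which
      \<open>u *\<^sub>R w\<close> has a preimage of modulus at most \<open>norm z\<close>. As
      \<open>T\<close> is closed, its infimum \<open>t\<close> belongs to it, and it remains to see
      that \<open>t = s\<close>.\<close>
    define T where "T = {s..1} \<inter> (\<lambda>t. t *\<^sub>R w) -` (f ` cball 0 (norm z))"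
    have "compact (f ` cball 0 (norm z))"
      by (intro compact_continuous_image continuous_on_subset[OF _ sub]
          holomorphic_on_imp_continuous_on[OF holf] compact_cball)
    then have clT: "closed T"
      unfolding T_def by (intro continuous_closed_vimage closed_Int compact_imp_closed) auto
    have T1: "1 \<in> T" using s by (auto simp: T_def w_def)
    have bdd: "bdd_below T" unfolding T_def by (auto intro!: bdd_belowI[of _ s])
    define t where "t = Inf T"
    have tT: "t \<in> T" unfolding t_def using closed_contains_Inf[OF _ bdd clT] T1 by auto
    then obtain x where x: "x \<in> cball 0 (norm z)" "t *\<^sub>R w = f x"
      by (auto simp: T_def)
    have xr: "x \<in> ball 0 r" using x sub by auto
    have "t = s"
    proof (rule ccontr)
      assume "t \<noteq> s"
      then have ts: "s < t" using tT by (auto simp: T_def)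
      then have t0: "0 < t" using s by simp
      then have fx: "f x \<noteq> 0" using x w0 by auto
      then have x0: "x \<noteq> 0" using f0 by auto
      define q where "q = x * deriv f x / f x"
      have q: "0 < Re q" using pos[OF xr x0] by (simp add: q_def)
      \<comment> \<open>The velocity of the pulled-back curve
        \<open>u \<mapsto> g (u *\<^sub>R w)\<close> at \<open>u = t\<close>. Substituting w = f x /
        t and g' = 1 / f' expresses it through \<open>q\<close>.\<close>
      define v where "v = w * deriv g (f x)"
      have "v = x / (of_real t * q)"
      proof -
        have d: "deriv f x \<noteq> 0" using dg[OF xr] by auto
        then have "deriv g (f x) = 1 / deriv f x"
          using dg[OF xr] by (simp add: eq_divide_eq mult.commute)
        moreover have "w = f x / of_real t" using x(2) t0 by (simp add: scaleR_conv_of_real field_simps)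
        ultimately show ?thesis using d fx x0 t0 by (simp add: v_def q_def)
      qed
      then have v: "v = (1 / t) *\<^sub>R (x * inverse q)"
        by (simp add: scaleR_conv_of_real field_simps)
      \<comment> \<open>Half the derivative of the squared modulus along the curve is
        \<open>x \<bullet> v\<close>, which by this identity has the sign of Re (1/q), hence that of
        Re q.\<close>
      have "x \<bullet> (x * c) = (norm x)\<^sup>2 * Re c" for c
        unfolding inner_complex_def cmod_power2 by (simp add: algebra_simps power2_eq_square)
      moreover have "0 < Re (inverse q)" using q by (auto intro!: divide_pos_pos add_pos_nonneg)
      ultimately have vpos: "0 < x \<bullet> v" using x0 t0 by (simp add: v del: inverse_complex.sel)
      have "(g has_field_derivative deriv g (f x)) (at (t *\<^sub>R w))"
        using holomorphic_derivI[OF holg opn] xr x(2) by auto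
      moreover have "((\<lambda>u. u *\<^sub>R w) has_vector_derivative w) (at t)"
        by (auto intro!: derivative_eq_intros)
      ultimately have "((\<lambda>u. g (u *\<^sub>R w)) has_vector_derivative v) (at t)"
        unfolding v_def using field_vector_diff_chain_at[of "\<lambda>u. u *\<^sub>R w" w t g]
        by (simp add: o_def)
      then have der: "((\<lambda>u. g (u *\<^sub>R w)) has_derivative (\<lambda>h. h *\<^sub>R v)) (at t)"
        by (simp add: has_vector_derivative_def)
      have gx: "g (t *\<^sub>R w) = x" using gf xr x(2) by simp
      have "((\<lambda>u. g (u *\<^sub>R w) \<bullet> g (u *\<^sub>R w)) has_real_derivative 2 * (x \<bullet> v)) (at t)"
        unfolding has_field_derivative_def
        by (rule has_derivative_eq_rhs[OF has_derivative_inner[OF der der]])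
          (auto simp: gx inner_commute fun_eq_iff)
      from DERIV_pos_inc_left[OF this] vpos obtain d where d: "d > 0"
        "\<And>h. 0 < h \<Longrightarrow> h < d \<Longrightarrow> g ((t - h) *\<^sub>R w) \<bullet> g ((t - h) *\<^sub>R w) < x \<bullet> x"
        by (auto simp: gx)
      \<comment> \<open>Openness of the image provides preimages for parameters slightly below
        \<open>t\<close>; these have modulus below \<open>norm x\<close>, so such a parameter lies
        in \<open>T\<close>, against the choice of \<open>t\<close>.\<close>
      have "((\<lambda>u. u *\<^sub>R w) \<longlongrightarrow> t *\<^sub>R w) (at_left t)" by (intro tendsto_intros)
      then have "\<forall>\<^sub>F u in at_left t. u *\<^sub>R w \<in> f ` ball 0 r"
        by (rule topological_tendstoD) (use opn xr x(2) in auto)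
      moreover have "\<forall>\<^sub>F u in at_left t. u \<in> {max s (t - d)<..<t}"
        using eventually_at_leftI[of "max s (t-d)" t] ts d(1) by auto
      ultimately have "\<forall>\<^sub>F u in at_left t. u *\<^sub>R w \<in> f ` ball 0 r \<and> u \<in> {max s (t - d)<..<t}"
        by (rule eventually_conj)
      then obtain u where u: "u *\<^sub>R w \<in> f ` ball 0 r" "s < u" "t - d < u" "u < t"
        using eventually_happens'[OF trivial_limit_at_left_real] by fastforce
      then obtain y where y: "y \<in> ball 0 r" "u *\<^sub>R w = f y" by auto
      have "y \<bullet> y < x \<bullet> x" using d(2)[of "t - u"] u y gf by simp
      then have "norm y \<le> norm x" by (simp add: norm_le)
      then have "u \<in> T" using x(1) y(2) u tT by (auto simp: T_def)
      then have "t \<le> u" unfolding t_def by (intro cInf_lower bdd)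
      then show False using u by simp
    qed
    then show ?thesis using x xr by (auto simp: w_def)
  qed
  show ?thesis
    unfolding starlike_wrt_def
  proof (intro conjI ballI)
    show "0 \<in> f ` ball 0 r" using f0 r by (auto intro!: image_eqI[of _ _ 0])
    show "closed_segment 0 x \<subseteq> f ` ball 0 r" if "x \<in> f ` ball 0 r" for x
      using that seg by (auto simp: closed_segment_def)
  qed
qed

section \<open>Functions z F(z) with F close to 1\<close>

lemma starlike_in_disc_factorI:
  fixes F :: "complex \<Rightarrow> complex"
  assumes holF: "F holomorphic_on ball 0 1" and F0: "F 0 = 1" and r: "0 < r" "r \<le> 1"
    and S: "S < 1"
    and bound: "\<And>z. z \<in> ball 0 r \<Longrightarrow> norm (F z - 1) + norm (z * deriv F z) \<le> S"
  shows "starlike_in_disc (\<lambda>z. z * F z) r"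
proof -
  define f where "f = (\<lambda>z. z * F z)"
  have holf: "f holomorphic_on ball 0 1" unfolding f_def by (intro holomorphic_intros holF)
  have der: "(f has_field_derivative (F z + z * deriv F z)) (at z)" if "z \<in> ball 0 1" for z
  proof -
    have "(F has_field_derivative deriv F z) (at z)"
      using holomorphic_derivI[OF holF open_ball that] .
    then show ?thesis unfolding f_def by (auto intro!: derivative_eq_intros)
  qed
  have df: "deriv f z = F z + z * deriv F z" if "z \<in> ball 0 1" for z
    using DERIV_imp_deriv[OF der[OF that]] .
  have sub: "ball (0::complex) r \<subseteq> ball 0 1" using r by auto
  have inj: "inj_on f (ball 0 r)"
  proof (rule inj_onI)
    fix x y assume xy: "x \<in> ball 0 r" "y \<in> ball 0 r" "f x = f y"
    \<comment> \<open>The derivative of f(z) - z is (F - 1) + z F', so f differs from the identity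
      by a strict contraction; f x = f y then forces x = y.\<close>
    have "norm ((f x - x) - (f y - y)) \<le> S * norm (x - y)"
    proof (rule field_differentiable_bound[of "ball 0 r" _ "\<lambda>z. F z + z * deriv F z - 1"])
      fix z :: complex assume z: "z \<in> ball 0 r"
      have "(f has_field_derivative (F z + z * deriv F z)) (at z within ball 0 r)"
        using der z sub has_field_derivative_at_within by blast
      then show "((\<lambda>z. f z - z) has_field_derivative F z + z * deriv F z - 1) (at z within ball 0 r)"
        by (auto intro!: derivative_eq_intros)
      have "norm ((F z - 1) + z * deriv F z) \<le> S"
        using bound[OF z] norm_triangle_ineq order_trans by blast
      then show "norm (F z + z * deriv F z - 1) \<le> S" by (simp add: algebra_simps)
    qed (use xy in auto)
    then have "(1 - S) * norm (x - y) \<le> 0"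
      using xy(3) by (simp add: algebra_simps norm_minus_commute)
    then show "x = y" using S by (simp add: mult_le_0_iff)
  qed
  have "starlike_wrt 0 (f ` ball 0 r)"
  proof (rule starlike_wrt_image_ball[OF holomorphic_on_subset[OF holf sub] inj _ r(1)])
    show "f 0 = 0" by (simp add: f_def)
    fix z :: complex assume z: "z \<in> ball 0 r" "z \<noteq> 0"
    \<comment> \<open>Thus |z F'| < 1 - |F - 1| \<le> |F|, which also excludes zeros of F.\<close>
    have "norm (1::complex) \<le> norm (F z) + norm (F z - 1)"
      by (metis norm_triangle_sub norm_minus_commute)
    then have lt: "norm (z * deriv F z) < norm (F z)" using bound[OF z(1)] S by simp
    then have Fz: "F z \<noteq> 0" by auto
    define e where "e = z * deriv F z / F z"
    have "norm e < 1" using lt Fz by (simp add: e_def norm_divide)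
    then have "Re e > -1" using abs_Re_le_cmod[of e] by linarith
    moreover have "z * deriv f z / f z = 1 + e"
      using df z sub Fz by (auto simp: f_def e_def field_simps)
    ultimately show "0 < Re (z * deriv f z / f z)" by simp
  qed
  then have "starlike_in_disc f r"
    using holf inj df[of 0] F0 by (simp add: starlike_in_disc_def f_def)
  then show ?thesis by (simp add: f_def)
qed

lemma starlike_in_disc_half_eval_fps:
  fixes F :: "complex fps"
  assumes F0: "fps_nth F 0 = 1"
    and sm: "summable (\<lambda>k. norm (fps_nth F (Suc k)))"
    and S: "(\<Sum>k. norm (fps_nth F (Suc k))) < 1"
  shows "starlike_in_disc (\<lambda>z. z * eval_fps F z) (1/2)"
proof (rule starlike_in_disc_factorI[OF _ _ _ _ S])
  have "summable (\<lambda>k. norm (fps_nth F k))" using sm summable_Suc_iff by blast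
  \<comment> \<open>Convergence at the point 1 gives radius of convergence at least 1.\<close>
  then have "summable (\<lambda>k. fps_nth F k * 1 ^ k)"
    by (intro summable_norm_cancel[of "\<lambda>k. fps_nth F k * 1 ^ k"]) simp
  then have rad: "1 \<le> fps_conv_radius F"
    unfolding fps_conv_radius_def using conv_radius_geI[of "fps_nth F" 1] by (simp add: one_ereal_def)
  have inside: "ereal (norm z) < fps_conv_radius F" if "norm z < 1" for z :: complex
    using that by (intro less_le_trans[OF _ rad]) (simp add: one_ereal_def)
  show "eval_fps F holomorphic_on ball 0 1"
    by (rule holomorphic_on_eval_fps) (auto simp: inside)
  show "eval_fps F 0 = 1" by (simp add: eval_fps_at_0 F0)
  fix z :: complex assume z: "z \<in> ball 0 (1/2)"
  have zr: "ereal (norm z) < fps_conv_radius F" using z by (intro inside) auto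
  then have zr': "ereal (norm z) < fps_conv_radius (fps_deriv F)"
    using fps_conv_radius_deriv[of F] by (rule less_le_trans)
  let ?u = "\<lambda>k. fps_nth F (Suc k) * z ^ Suc k"
  let ?v = "\<lambda>k. of_nat (Suc k) * fps_nth F (Suc k) * z ^ Suc k"
  have u: "?u sums (eval_fps F z - 1)"
    using sums_eval_fps[OF zr] by (subst sums_Suc_iff) (simp add: F0)
  have v: "?v sums (z * deriv (eval_fps F) z)"
    using sums_mult[OF sums_eval_fps[OF zr'], of z] by (simp add: eval_fps_deriv[OF zr] mult_ac)
  have pt: "norm (?u k) + norm (?v k) \<le> norm (fps_nth F (Suc k))" for k
  proof -
    \<comment> \<open>The factor k + 2 is 1 from F - 1 plus k + 1 from z F'. The radius 1/2 is what
      absorbs it.\<close>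
    have "real k + 2 \<le> 2 ^ Suc k" by (induction k) auto
    then have "(real k + 2) * (1/2) ^ Suc k \<le> 1" by (simp add: power_divide)
    moreover have "norm z ^ Suc k \<le> (1/2) ^ Suc k" using z by (intro power_mono) auto
    ultimately have "(real k + 2) * norm z ^ Suc k \<le> 1"
      by (meson mult_left_mono of_nat_0_le_iff order_trans add_nonneg_nonneg zero_le_numeral)
    then have "norm (fps_nth F (Suc k)) * ((real k + 2) * norm z ^ Suc k) \<le> norm (fps_nth F (Suc k))"
      by (simp add: mult_left_le)
    moreover have "norm (of_nat (Suc k) :: complex) = real k + 1"
      by (subst norm_of_nat) simp
    ultimately show ?thesis by (simp only: norm_mult norm_power) (simp add: algebra_simps)
  qed
  have su: "summable (\<lambda>k. norm (?u k))" and sv: "summable (\<lambda>k. norm (?v k))"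
    by (rule summable_comparison_test'[OF sm, of 0]; use pt in \<open>smt (verit) norm_ge_zero real_norm_def\<close>)+
  have "norm (eval_fps F z - 1) \<le> (\<Sum>k. norm (?u k))"
    using summable_norm[OF su] u by (simp add: sums_iff)
  moreover have "norm (z * deriv (eval_fps F) z) \<le> (\<Sum>k. norm (?v k))"
    using summable_norm[OF sv] v by (simp add: sums_iff)
  moreover have "(\<Sum>k. norm (?u k)) + (\<Sum>k. norm (?v k)) \<le> (\<Sum>k. norm (fps_nth F (Suc k)))"
    unfolding suminf_add[OF su sv] by (intro suminf_le summable_add su sv sm pt)
  ultimately show "norm (eval_fps F z - 1) + norm (z * deriv (eval_fps F) z)
      \<le> (\<Sum>k. norm (fps_nth F (Suc k)))"
    by linarith
qed auto

section \<open>Estimates for the hypergeometric coefficients\<close>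

lemma fps_nth_hypergeo_of_real:
  assumes "length a = p" "length b = p"
  shows "fps_nth (fps_hypergeo (map complex_of_real a) (map complex_of_real b) 1) k =
    of_real ((\<Prod>i<p. pochhammer (a ! i) k / pochhammer (b ! i) k) / fact k)"
proof -
  have "foldl (\<lambda>r x. r * pochhammer x k) c (map complex_of_real xs) =
      c * of_real (\<Prod>i<length xs. pochhammer (xs ! i) k)" for c xs
  proof (induction xs arbitrary: c)
    case (Cons x xs)
    then show ?case
      by (simp add: pochhammer_of_real prod.lessThan_Suc_shift mult.assoc del: prod.lessThan_Suc)
  qed simp
  then show ?thesis using assms by (simp add: prod_dividef)
qed

lemma pochhammer_ratio_le_1:
  fixes a b :: real
  assumes "0 < a" "a \<le> b"
  shows "pochhammer a k / pochhammer b k \<le> 1"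
proof -
  have "pochhammer a k \<le> pochhammer b k"
    unfolding pochhammer_prod using assms by (intro prod_mono) auto
  then show ?thesis using assms pochhammer_pos[of b k] by simp
qed

text \<open>Passing from \<open>n\<close> to \<open>k\<close> multiplies the quotient by (a+n)_{k-n}
  / (b+n)_{k-n}, again a quotient with ordered parameters.\<close>

lemma pochhammer_ratio_le:
  fixes a b :: real
  assumes "0 < a" "a \<le> b" "n \<le> k"
  shows "pochhammer a k / pochhammer b k \<le> pochhammer a n / pochhammer b n"
proof -
  have "pochhammer a k / pochhammer b k = pochhammer a n / pochhammer b n *
      (pochhammer (a + n) (k - n) / pochhammer (b + n) (k - n))"
    using assms(3) by (simp add: pochhammer_product[of n k])
  also have "\<dots> \<le> pochhammer a n / pochhammer b n * 1"
    using assms pochhammer_pos[of a n] pochhammer_pos[of b n]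
    by (intro mult_left_mono pochhammer_ratio_le_1) auto
  finally show ?thesis by simp
qed

text \<open>The right side of \<open>ab\<close> is the larger root in b of (b - a)(b + 1) = a (e -
  1)(a + 1). Beyond it the left side is the greater one; dividing by b (b + 1) gives the first
  claim, and positivity of the right side gives a < b.\<close>

lemma lower_root_bound:
  fixes a b :: real
  assumes a: "0 < a" and b: "0 < b"
    and ab: "b > (a - 1 + sqrt ((a + 1)\<^sup>2 + 4 * a * (exp 1 - 1) * (a + 1))) / 2"
  shows "a / b + (exp 1 - 1) * (a * (a + 1) / (b * (b + 1))) < 1" and "a < b"
proof -
  let ?D = "(a + 1)\<^sup>2 + 4 * a * (exp 1 - 1) * (a + 1)"
  have e: "(1::real) < exp 1" by simp
  then have pos: "0 < a * (exp 1 - 1) * (a + 1)" using a by simp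
  have "sqrt ?D < 2 * b - a + 1" using ab by simp
  moreover have "0 \<le> ?D" using a e by (intro add_nonneg_nonneg mult_nonneg_nonneg) auto
  ultimately have "?D < (2 * b - a + 1)\<^sup>2"
    by (metis real_sqrt_ge_zero real_sqrt_pow2 power_strict_mono zero_less_numeral)
  then have *: "a * (exp 1 - 1) * (a + 1) < (b - a) * (b + 1)"
    by (simp add: power2_eq_square algebra_simps)
  then show "a < b" using pos b by (smt (verit) mult_nonpos_nonneg)
  have "a / b = a * (b + 1) / (b * (b + 1))" using b by simp
  then have "a / b + (exp 1 - 1) * (a * (a + 1) / (b * (b + 1))) =
      (a * (b + 1) + a * (exp 1 - 1) * (a + 1)) / (b * (b + 1))"
    by (simp add: add_divide_distrib mult_ac)
  also have "\<dots> < 1"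
    using b * by (simp add: divide_less_eq) (simp add: algebra_simps)
  finally show "a / b + (exp 1 - 1) * (a * (a + 1) / (b * (b + 1))) < 1" .
qed

theorem corollary4:
  fixes p :: nat and a b :: "real list"
  assumes "p \<ge> 1" and "length a = p" and "length b = p"
    and "\<And>i. i < p \<Longrightarrow> a ! i > 0"
    and "\<And>i. i < p \<Longrightarrow> b ! i > 0"
    and "\<And>i. i < p \<Longrightarrow>
           b ! i > (a ! i - 1 + sqrt ((a ! i + 1)\<^sup>2 + 4 * (a ! i) * (exp 1 - 1) * (a ! i + 1))) / 2"
  shows "starlike_in_disc
           (hypergeom_normalized (map complex_of_real a) (map complex_of_real b)) (1/2)"
proof -
  define F where "F = fps_hypergeo (map complex_of_real a) (map complex_of_real b) 1"
  define q where "q = (\<lambda>i k. pochhammer (a ! i) k / pochhammer (b ! i) k)"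
  define A B where "A = a ! 0" and "B = b ! 0"
  define Q where "Q = A * (A + 1) / (B * (B + 1))"
  have AB: "0 < A" "0 < B" "A / B + (exp 1 - 1) * Q < 1" "A < B"
    using assms(1,4,5) lower_root_bound[OF assms(4-6), of 0] by (auto simp: A_def B_def Q_def)
  have Q: "0 \<le> Q" using AB by (simp add: Q_def)
  have q01: "0 \<le> q i k" "q i k \<le> 1" if "i < p" for i k
    using assms(4,5)[OF that] lower_root_bound(2)[OF assms(4-6)[OF that]]
      pochhammer_pos[of "a ! i" k] pochhammer_pos[of "b ! i" k] pochhammer_ratio_le_1[of "a ! i" "b ! i" k]
    by (simp_all add: q_def)
  have nF: "norm (fps_nth F k) \<le> q 0 k / fact k" for k
  proof -
    \<comment> \<open>Only the first parameter pair is kept; the other quotients are bounded by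
      1.\<close>
    have "{..<p} = insert 0 {1..<p}" using assms(1) by auto
    then have "(\<Prod>i<p. q i k) = q 0 k * (\<Prod>i=1..<p. q i k)" by simp
    also have "\<dots> \<le> q 0 k * 1"
      using assms(1) q01 by (intro mult_left_mono prod_le_1) auto
    finally have "(\<Prod>i<p. q i k) \<le> q 0 k" by simp
    moreover have "0 \<le> (\<Prod>i<p. q i k)" using q01 by (intro prod_nonneg) auto
    moreover have "fps_nth F k = of_real ((\<Prod>i<p. q i k) / fact k)"
      unfolding F_def q_def using assms(2,3) by (rule fps_nth_hypergeo_of_real)
    ultimately show ?thesis by (simp add: norm_divide divide_right_mono del: of_real_prod)
  qed
  \<comment> \<open>A majorant with index shifted by one: \<open>A / B\<close> bounds the
    coefficient of z, and \<open>Q\<close>, the value of \<open>q 0 2\<close>, bounds all later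
    quotients. The extra \<open>Q\<close> at \<open>k = 0\<close> completes the sum of 1/(k+1)! to e
    - 1, the constant in the hypothesis on \<open>b\<close>.\<close>
  define d where "d = (\<lambda>k::nat. Q / fact (Suc k) + (if k = 0 then A / B else 0))"
  have bound: "norm (fps_nth F (Suc k)) \<le> d k" for k
  proof (cases "k = 0")
    case True
    then show ?thesis using nF[of 1] Q by (simp add: d_def q_def A_def B_def)
  next
    case False
    then have "q 0 (Suc k) \<le> q 0 2"
      unfolding q_def using AB by (intro pochhammer_ratio_le) (auto simp: A_def B_def)
    also have "q 0 2 = Q" by (simp add: q_def Q_def A_def B_def numeral_2_eq_2 pochhammer_Suc)
    finally have "q 0 (Suc k) / fact (Suc k) \<le> Q / fact (Suc k)"
      by (intro divide_right_mono) auto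
    then show ?thesis using nF[of "Suc k"] False by (simp add: d_def)
  qed
  have "(\<lambda>k. 1 / fact k :: real) sums exp 1"
    using exp_converges[of "1::real"] by (simp add: divide_inverse)
  then have "(\<lambda>k. 1 / fact (Suc k) :: real) sums (exp 1 - 1)"
    by (subst sums_Suc_iff) simp
  then have "d sums ((exp 1 - 1) * Q + A / B)"
    unfolding d_def using sums_add[OF sums_mult2[of _ _ Q] sums_single[of 0 "\<lambda>_. A / B"]]
    by fastforce
  then have d: "summable d" "suminf d < 1" using AB by (auto simp: sums_iff)
  have sm: "summable (\<lambda>k. norm (fps_nth F (Suc k)))"
    using bound by (intro summable_comparison_test'[OF d(1), of 0]) auto
  have "(\<Sum>k. norm (fps_nth F (Suc k))) < 1"
    using suminf_le[OF bound sm d(1)] d(2) by linarith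
  moreover have "fps_nth F 0 = 1" unfolding F_def by (rule fps_hypergeo_0)
  ultimately have "starlike_in_disc (\<lambda>z. z * eval_fps F z) (1/2)"
    using starlike_in_disc_half_eval_fps sm by blast
  moreover have "hypergeom_normalized (map complex_of_real a) (map complex_of_real b) =
      (\<lambda>z. z * eval_fps F z)"
    by (simp add: fun_eq_iff hypergeom_normalized_def hypergeom_def F_def)
  ultimately show ?thesis by simp
qed

end
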